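(* Let $n\ge 2$ and let $\alpha\in(-1/n,0)$. Let $\mathcal{C}(n,\alpha)$ be the smallest constant such that $\|\Delta_\alpha f\|_1\le\mathcal{C}(n,\alpha)\|f\|_1$ for every integrable $f\in C_\alpha(\mathbb{R}^n)$ with full-dimensional support. Then $$\mathcal{C}(n,\alpha)\le\min\left\{\frac{n+1}{2^n}\binom{2n}{n},\ \frac{2^n}{\prod_{j=1}^n(1+j\alpha)}\right\}.$$
   Context: For $\alpha\in(-\infty,0)$, a function $f:\mathbb{R}^n\to[0,\infty)$ is $\alpha$-concave if for all $x,y$ with $f(x),f(y)>0$ and all $\lambda\in[0,1]$, $f(\lambda x+(1-\lambda)y)\ge[\lambda f(x)^\alpha+(1-\lambda)f(y)^\alpha]^{1/\alpha}$. $C_\alpha(\mathbb{R}^n)$ is the set of upper semicontinuous $\alpha$-concave $f:\mathbb{R}^n\to[0,\infty)$ with $\|f\|_\infty=f(0)=1$ and $\lim_{|x|\to\infty}f(x)=0$. The support of $f$ is $\{f>0\}$; full-dimensional means it has nonempty interior. The difference function of order $\alpha$ (for $-\infty<\alpha<0$) is $$\Delta_\alpha f(x)=\sup_{y+z=2x}M_\alpha\big(f(y),\bar f(z)\big),\qquad M_\alpha(a,b)=\left(\frac{a^\alpha+b^\alpha}{2}\right)^{1/\alpha},$$ with $M_\alpha(a,b)=0$ if $a=0$ or $b=0$, and $\bar f(z)=f(-z)$. $\|f\|_1=\int_{\mathbb{R}^n}f(x)\,dx$ for $f\ge0$. *)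

theory Defs
  imports "HOL-Analysis.Analysis"
begin

text \<open>Only meant for \<^term>\<open>\<alpha> < (0::real)\<close>; the side conditions \<open>f x > 0\<close>, \<open>f y > 0\<close> keep
  \<open>powr\<close> away from its convention \<open>0 powr a = 0\<close>.\<close>

definition alpha_concave :: "real \<Rightarrow> ('a::real_vector \<Rightarrow> real) \<Rightarrow> bool" where
  "alpha_concave \<alpha> f \<longleftrightarrow>
     (\<forall>x y. \<forall>t\<in>{0..1}. f x > 0 \<longrightarrow> f y > 0 \<longrightarrow>
        f (t *\<^sub>R x + (1 - t) *\<^sub>R y) \<ge> (t * f x powr \<alpha> + (1 - t) * f y powr \<alpha>) powr (1 / \<alpha>))"

definition upper_semicontinuous :: "('a::topological_space \<Rightarrow> real) \<Rightarrow> bool" where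
  "upper_semicontinuous f \<longleftrightarrow> (\<forall>x c. f x < c \<longrightarrow> (\<forall>\<^sub>F y in at x. f y < c))"

text \<open>Pointwise (not essential) supremum: supports of empty interior are allowed in \<open>C_alpha\<close>.
  It is extended-real valued so that no boundedness is presupposed.\<close>

definition sup_norm :: "('a \<Rightarrow> real) \<Rightarrow> ereal" where
  "sup_norm f = (SUP x. ereal \<bar>f x\<bar>)"

definition C_alpha :: "real \<Rightarrow> ('a::real_normed_vector \<Rightarrow> real) set" where
  "C_alpha \<alpha> =
     {f. (\<forall>x. 0 \<le> f x) \<and> upper_semicontinuous f \<and> alpha_concave \<alpha> f \<and>
         sup_norm f = ereal (f 0) \<and> f 0 = 1 \<and> (f \<longlongrightarrow> 0) at_infinity}"

definition full_dim_support :: "('a::topological_space \<Rightarrow> real) \<Rightarrow> bool" where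
  "full_dim_support f \<longleftrightarrow> interior {x. f x > 0} \<noteq> {}"

definition M_alpha :: "real \<Rightarrow> real \<Rightarrow> real \<Rightarrow> real" where
  "M_alpha \<alpha> a b =
     (if a = 0 \<or> b = 0 then 0 else ((a powr \<alpha> + b powr \<alpha>) / 2) powr (1 / \<alpha>))"

text \<open>The supremum is taken in \<^typ>\<open>real\<close>. For \<open>\<alpha> < 0\<close> and \<open>f \<in> C_alpha \<alpha>\<close> the set is nonempty
  and contained in \<open>{0..1}\<close>, so it is the true supremum.\<close>

definition difference_function :: "real \<Rightarrow> ('a::real_vector \<Rightarrow> real) \<Rightarrow> 'a \<Rightarrow> real" where
  "difference_function \<alpha> f x = Sup {M_alpha \<alpha> (f y) (f (- z)) | y z. y + z = 2 *\<^sub>R x}"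

definition L1_norm :: "('a::euclidean_space \<Rightarrow> real) \<Rightarrow> ennreal" where
  "L1_norm f = (\<integral>\<^sup>+ x. ennreal \<bar>f x\<bar> \<partial>lborel)"

definition admissible_constant :: "'n::finite itself \<Rightarrow> real \<Rightarrow> ennreal \<Rightarrow> bool" where
  "admissible_constant N \<alpha> C \<longleftrightarrow>
     (\<forall>f :: real ^ 'n \<Rightarrow> real. f \<in> C_alpha \<alpha> \<longrightarrow> integrable lborel f \<longrightarrow> full_dim_support f \<longrightarrow>
        L1_norm (difference_function \<alpha> f) \<le> C * L1_norm f)"

text \<open>The dimension \<open>n\<close> is \<open>CARD('n)\<close>. In \<^typ>\<open>ennreal\<close>, the value \<open>\<infinity>\<close> would mean that there is no
  finite constant. By \<open>admissible_constant_iff\<close> below the infimum is attained.\<close>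

definition best_constant :: "'n::finite itself \<Rightarrow> real \<Rightarrow> ennreal" where
  "best_constant N \<alpha> = Inf {C. admissible_constant N \<alpha> C}"

lemma L1_norm_pos:
  fixes f :: "'a::euclidean_space \<Rightarrow> real"
  assumes "integrable lborel f" "full_dim_support f"
  shows "L1_norm f \<noteq> 0"
proof
  assume "L1_norm f = 0"
  moreover have "f \<in> borel_measurable borel"
    using assms(1) by simp
  ultimately have "AE x in lborel. f x = 0"
    by (simp add: L1_norm_def nn_integral_0_iff_AE)
  then have "AE x in lborel. x \<notin> interior {x. f x > 0}"
    by eventually_elim (use interior_subset in fastforce)
  then have "negligible (interior {x. f x > 0})"
    by (subst (asm) AE_iff_null_sets[symmetric])
      (auto simp: negligible_iff_null_sets intro: null_sets_completionI)
  then show False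
    using open_not_negligible assms(2) unfolding full_dim_support_def by blast
qed

lemma admissible_constant_iff: "admissible_constant N \<alpha> C \<longleftrightarrow> best_constant N \<alpha> \<le> C"
  for N :: "'n::finite itself"
proof -
  have *: "L1_norm (difference_function \<alpha> f) \<le> D * L1_norm f \<longleftrightarrow>
           L1_norm (difference_function \<alpha> f) / L1_norm f \<le> D"
    if "integrable lborel f" "full_dim_support f" for f :: "real ^ 'n \<Rightarrow> real" and D
  proof -
    have "L1_norm f < \<infinity>"
      using that(1) by (simp add: L1_norm_def integrable_iff_bounded)
    then have nt: "L1_norm f \<noteq> 0" "L1_norm f \<noteq> top" "L1_norm f < top"
      using L1_norm_pos[OF that] by auto
    show ?thesis (is "?A \<le> _ \<longleftrightarrow> _")
    proof
      assume "?A \<le> D * L1_norm f"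
      then have "?A / L1_norm f \<le> D * L1_norm f / L1_norm f"
        by (rule divide_right_mono_ennreal)
      then show "?A / L1_norm f \<le> D"
        using nt by (simp add: ennreal_mult_divide_eq)
    next
      assume "?A / L1_norm f \<le> D"
      then have "?A / L1_norm f * L1_norm f \<le> D * L1_norm f"
        by (rule mult_right_mono) simp
      then show "?A \<le> D * L1_norm f"
        using nt by (simp add: ennreal_divide_times)
    qed
  qed
  have mono: "admissible_constant N \<alpha> D" if "admissible_constant N \<alpha> B" "B \<le> D" for B D
    using that unfolding admissible_constant_def
    by (meson mult_right_mono order_trans zero_le)
  have "admissible_constant N \<alpha> (best_constant N \<alpha>)"
    unfolding admissible_constant_def
  proof (intro allI impI)
    fix f :: "real ^ 'n \<Rightarrow> real"
    assume f: "f \<in> C_alpha \<alpha>" "integrable lborel f" "full_dim_support f"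
    have "L1_norm (difference_function \<alpha> f) / L1_norm f \<le> best_constant N \<alpha>"
      unfolding best_constant_def
    proof (rule Inf_greatest)
      fix D assume "D \<in> {C. admissible_constant N \<alpha> C}"
      then have "L1_norm (difference_function \<alpha> f) \<le> D * L1_norm f"
        using f unfolding admissible_constant_def by blast
      then show "L1_norm (difference_function \<alpha> f) / L1_norm f \<le> D"
        using *[OF f(2,3)] by blast
    qed
    then show "L1_norm (difference_function \<alpha> f) \<le> best_constant N \<alpha> * L1_norm f"
      using *[OF f(2,3)] by blast
  qed
  then show ?thesis
    using mono[of "best_constant N \<alpha>" C] Inf_lower[of C "{C. admissible_constant N \<alpha> C}"]
    unfolding best_constant_def by blast
qed

end

theory Submission
  imports Defs
begin

text \<open>The two numbers in the minimum are both at least \<open>2\<^sup>n\<close>, so it is enough to show that the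
  constant \<open>2\<^sup>n\<close> is admissible.

  Put \<open>p = - 1 / \<alpha>\<close> and \<open>\<phi> = f powr \<alpha>\<close>, a convex function on the support of \<open>f\<close>. In terms of
  \<open>\<phi>\<close> the difference function is given by
  \<open>\<Delta>f(x) powr \<alpha> = inf {(\<phi> y + \<phi> z) / 2 | y - z = 2x}\<close> with \<open>y\<close>, \<open>z\<close> in the support, a formula
  that commutes with multiplying \<open>\<phi>\<close> by a scalar \<open>s > 0\<close>. Since \<open>f = \<phi> powr (- p)\<close>, Euler's integral writes \<open>f\<close> as a mixture of
  the log-concave functions \<open>g\<^sub>s = exp (- s \<phi>)\<close>,
  \<open>\<Gamma>(p) f(x) = \<integral> s powr (p - 1) g\<^sub>s(x) ds\<close>, and it writes \<open>\<Delta>f\<close> in the same way as a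
  mixture of the functions \<open>G\<^sub>s = exp (- s (\<Delta>f) powr \<alpha>)\<close>. Hence it is enough to prove
  \<open>\<integral> G\<^sub>s \<le> 2\<^sup>n \<integral> g\<^sub>s\<close> for each \<open>s\<close>, the case of log-concave functions.

  That case follows from one use of convexity at midpoints. If \<open>y - z = 2x\<close>, then
  \<open>(y + w) / 2\<close> and \<open>(z + w) / 2\<close> differ by \<open>x\<close>, and
  \<open>exp (- s (\<phi> y + \<phi> z) / 2) g\<^sub>s(w) \<le> g\<^sub>s((y + w) / 2) g\<^sub>s((z + w) / 2)\<close>.
  Integrating over \<open>w\<close> gives \<open>G\<^sub>s(x) \<integral> g\<^sub>s \<le> 2\<^sup>n \<integral> g\<^sub>s(x + w) g\<^sub>s(w) dw\<close>, the factor
  \<open>2\<^sup>n\<close> being the Jacobian of the halving (\<open>covariogram_lower_bound\<close>,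
  \<open>laplace_kernel_difference_function_le\<close>). Integrating over \<open>x\<close>, the right-hand side becomes
  \<open>2\<^sup>n (\<integral> g\<^sub>s)\<^sup>2\<close> (\<open>nn_integral_covariogram\<close>), and a factor \<open>\<integral> g\<^sub>s\<close> cancels.\<close>

section \<open>Comparing the two constants with a power of two\<close>

text \<open>The row sum \<open>2\<^sup>n\<close> and the sum of squares \<open>(2n choose n)\<close> of the binomial coefficients are
  related by the Cauchy-Schwarz inequality.\<close>

lemma two_power_le_central_binomial:
  "2 ^ n \<le> (real n + 1) / 2 ^ n * real ((2 * n) choose n)"
proof -
  have "(real (\<Sum>k\<le>n. n choose k))\<^sup>2 \<le> real (card {..n}) * (\<Sum>k\<le>n. (real (n choose k))\<^sup>2)"
    using sum_squared_le_sum_of_squares[of "\<lambda>k. real (n choose k)" "{..n}"]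
    by (simp add: mult.commute)
  also have "(\<Sum>k\<le>n. (real (n choose k))\<^sup>2) = real ((2 * n) choose n)"
    by (simp flip: choose_square_sum)
  finally have "2 ^ n * 2 ^ n \<le> (real n + 1) * real ((2 * n) choose n)"
    by (simp add: choose_row_sum power2_eq_square add.commute del: of_nat_sum)
  then show ?thesis
    by (simp add: field_simps)
qed

lemma two_power_le_power_div_prod:
  assumes "- 1 / real n < \<alpha>" "\<alpha> < 0"
  shows "2 ^ n \<le> 2 ^ n / (\<Prod>j = 1..n. (1 + real j * \<alpha>))"
proof -
  have *: "0 < 1 + real j * \<alpha> \<and> 1 + real j * \<alpha> \<le> 1" if "j \<in> {1..n}" for j
  proof -
    have "real j * (- \<alpha>) \<le> real n * (- \<alpha>)"
      using that assms by (intro mult_right_mono) auto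
    moreover have "real n * (- \<alpha>) < 1"
      using that assms by (simp add: field_simps)
    moreover have "real j * \<alpha> \<le> 0"
      using assms by (simp add: mult_nonneg_nonpos)
    ultimately show ?thesis
      by simp
  qed
  then have "(\<Prod>j = 1..n. (1 + real j * \<alpha>)) \<le> 1" "0 < (\<Prod>j = 1..n. (1 + real j * \<alpha>))"
    by (auto intro!: prod_le_1 prod_pos simp: less_imp_le)
  then show ?thesis
    by (simp add: field_simps)
qed

section \<open>Integrals of products of translates\<close>

lemma nn_integral_lborel_affine:
  fixes h :: "'a::euclidean_space \<Rightarrow> ennreal"
  assumes [measurable]: "h \<in> borel_measurable borel" and "c \<noteq> 0"
  shows "(\<integral>\<^sup>+ x. h x \<partial>lborel) = ennreal (\<bar>c\<bar> ^ DIM('a)) * (\<integral>\<^sup>+ x. h (t + c *\<^sub>R x) \<partial>lborel)"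
  by (subst lborel_affine[OF assms(2), of t])
     (simp add: nn_integral_density nn_integral_distr nn_integral_cmult)

lemma nn_integral_lborel_translate:
  fixes h :: "'a::euclidean_space \<Rightarrow> ennreal"
  assumes "h \<in> borel_measurable borel"
  shows "(\<integral>\<^sup>+ x. h (t + x) \<partial>lborel) = (\<integral>\<^sup>+ x. h x \<partial>lborel)"
  using nn_integral_lborel_affine[OF assms, of 1 t] by simp

text \<open>The points \<open>(y + w) / 2\<close> and \<open>(z + w) / 2\<close> differ by \<open>x\<close>, so the substitution
  \<open>w \<mapsto> (z + w) / 2\<close> turns the integral over \<open>w\<close> of the right-hand side of the pointwise hypothesis
  into the covariogram of \<open>g\<close> at \<open>x\<close>; its Jacobian is the constant.\<close>

lemma covariogram_lower_bound:
  fixes g :: "'a::euclidean_space \<Rightarrow> ennreal"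
  assumes [measurable]: "g \<in> borel_measurable borel"
    and yz: "y = z + 2 *\<^sub>R x"
    and mid: "\<And>w. \<kappa> * g w \<le> g ((1/2) *\<^sub>R y + (1/2) *\<^sub>R w) * g ((1/2) *\<^sub>R z + (1/2) *\<^sub>R w)"
  shows "\<kappa> * (\<integral>\<^sup>+ w. g w \<partial>lborel) \<le> 2 ^ DIM('a) * (\<integral>\<^sup>+ w. g (x + w) * g w \<partial>lborel)"
proof -
  have "\<kappa> * (\<integral>\<^sup>+ w. g w \<partial>lborel) = (\<integral>\<^sup>+ w. \<kappa> * g w \<partial>lborel)"
    by (simp add: nn_integral_cmult)
  also have "\<dots> \<le> (\<integral>\<^sup>+ w. g (x + ((1/2) *\<^sub>R z + (1/2) *\<^sub>R w)) * g ((1/2) *\<^sub>R z + (1/2) *\<^sub>R w) \<partial>lborel)"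
    using mid by (intro nn_integral_mono) (simp add: yz scaleR_add_right add_ac)
  also have "\<dots> = ennreal (2 ^ DIM('a)) * (ennreal (\<bar>1/2\<bar> ^ DIM('a)) *
      (\<integral>\<^sup>+ w. g (x + ((1/2) *\<^sub>R z + (1/2) *\<^sub>R w)) * g ((1/2) *\<^sub>R z + (1/2) *\<^sub>R w) \<partial>lborel))"
    by (simp add: mult.assoc[symmetric] ennreal_mult[symmetric] power_mult_distrib[symmetric] del: ennreal_power)
  also have "\<dots> = 2 ^ DIM('a) * (\<integral>\<^sup>+ w. g (x + w) * g w \<partial>lborel)"
    by (subst (2) nn_integral_lborel_affine[where c = "1/2" and t = "(1/2) *\<^sub>R z"])
       (simp_all flip: ennreal_power)
  finally show ?thesis .
qed

lemma nn_integral_covariogram: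
  fixes g :: "'a::euclidean_space \<Rightarrow> ennreal"
  assumes [measurable]: "g \<in> borel_measurable borel"
  shows "(\<integral>\<^sup>+ x. (\<integral>\<^sup>+ w. g (x + w) * g w \<partial>lborel) \<partial>lborel) = (\<integral>\<^sup>+ w. g w \<partial>lborel) * (\<integral>\<^sup>+ w. g w \<partial>lborel)"
proof -
  have "(\<integral>\<^sup>+ x. (\<integral>\<^sup>+ w. g (x + w) * g w \<partial>lborel) \<partial>lborel) =
      (\<integral>\<^sup>+ w. (\<integral>\<^sup>+ x. g (x + w) * g w \<partial>lborel) \<partial>lborel)"
    by (rule lborel_pair.Fubini') measurable
  also have "\<dots> = (\<integral>\<^sup>+ w. (\<integral>\<^sup>+ x. g (w + x) \<partial>lborel) * g w \<partial>lborel)"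
    by (simp add: nn_integral_multc add.commute)
  also have "\<dots> = (\<integral>\<^sup>+ w. g w \<partial>lborel) * (\<integral>\<^sup>+ w. g w \<partial>lborel)"
    by (simp add: nn_integral_lborel_translate nn_integral_cmult)
  finally show ?thesis .
qed

section \<open>Alpha-concave functions as mixtures of log-concave functions\<close>

lemma nn_integral_Gamma_scaled:
  assumes "0 < p" "0 < c"
  shows "(\<integral>\<^sup>+ s. ennreal (indicator {0..} s * s powr (p - 1)) * ennreal (exp (- (s * c))) \<partial>lborel) =
    ennreal (Gamma p) * ennreal (c powr - p)"
proof -
  have *: "indicator {0..} (c * s) * (c * s) powr (p - 1) / exp (c * s) =
      c powr (p - 1) * (indicator {0..} s * s powr (p - 1) * exp (- (s * c)))" for s :: real
    using assms by (auto simp: indicator_def powr_mult exp_minus field_simps zero_le_mult_iff)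
  have "ennreal (Gamma p) =
      (\<integral>\<^sup>+ s. ennreal (indicator {0..} s * s powr (p - 1) / exp s) \<partial>lborel)"
    using Gamma_conv_nn_integral_real[of p] assms by simp
  also have "\<dots> = ennreal c *
      (\<integral>\<^sup>+ s. ennreal (indicator {0..} (c * s) * (c * s) powr (p - 1) / exp (c * s)) \<partial>lborel)"
    using nn_integral_lborel_affine[where c = c and t = 0 and
        h = "\<lambda>s. ennreal (indicator {0..} s * s powr (p - 1) / exp s)"] assms by simp
  also have "\<dots> = ennreal c * (ennreal (c powr (p - 1)) *
      (\<integral>\<^sup>+ s. ennreal (indicator {0..} s * s powr (p - 1)) * ennreal (exp (- (s * c))) \<partial>lborel))"
    unfolding * by (subst nn_integral_cmult[symmetric]) (auto simp: ennreal_mult)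
  also have "\<dots> = ennreal (c powr p) *
      (\<integral>\<^sup>+ s. ennreal (indicator {0..} s * s powr (p - 1)) * ennreal (exp (- (s * c))) \<partial>lborel)"
    using assms by (simp add: mult.assoc[symmetric] ennreal_mult[symmetric] powr_diff)
  finally have "ennreal (c powr - p) * ennreal (Gamma p) =
      ennreal (c powr - p) * ennreal (c powr p) *
      (\<integral>\<^sup>+ s. ennreal (indicator {0..} s * s powr (p - 1)) * ennreal (exp (- (s * c))) \<partial>lborel)"
    by (simp add: mult.assoc)
  also have "ennreal (c powr - p) * ennreal (c powr p) = 1"
    using assms by (simp add: ennreal_mult[symmetric] powr_add[symmetric])
  finally show ?thesis
    by (simp add: mult.commute)
qed

text \<open>The function \<open>exp (- s f powr \<alpha>)\<close>, log-concave when \<open>f\<close> is \<open>\<alpha>\<close>-concave with \<open>\<alpha> < 0\<close>. Off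
  the support the correct value is \<open>0\<close>, because there \<open>f powr \<alpha>\<close> stands for \<open>\<infinity>\<close>, while the
  convention for \<open>powr\<close> would give \<open>1\<close>.\<close>

definition laplace_kernel :: "real \<Rightarrow> ('a \<Rightarrow> real) \<Rightarrow> real \<Rightarrow> 'a \<Rightarrow> ennreal" where
  "laplace_kernel \<alpha> f s x = (if f x > 0 then ennreal (exp (- (s * f x powr \<alpha>))) else 0)"

lemma measurable_laplace_kernel [measurable]:
  assumes [measurable]: "f \<in> borel_measurable borel"
  shows "(\<lambda>(s, x). laplace_kernel \<alpha> f s x) \<in> borel_measurable (borel \<Otimes>\<^sub>M borel)"
  unfolding laplace_kernel_def by measurable

text \<open>Euler's integral for \<open>f x = (f x powr \<alpha>) powr (1 / \<alpha>)\<close>. It will be used for a function and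
  for its difference function.\<close>

lemma nn_integral_laplace_kernel:
  assumes "\<alpha> < 0" "0 \<le> f x"
  shows "(\<integral>\<^sup>+ s. ennreal (indicator {0..} s * s powr (- 1 / \<alpha> - 1)) * laplace_kernel \<alpha> f s x \<partial>lborel) =
    ennreal (Gamma (- 1 / \<alpha>)) * ennreal (f x)"
proof (cases "f x = 0")
  case False
  then have "f x > 0" using assms by simp
  then show ?thesis
    using nn_integral_Gamma_scaled[of "- 1 / \<alpha>" "f x powr \<alpha>"] assms
    by (simp add: laplace_kernel_def powr_powr)
qed (simp add: laplace_kernel_def)

lemma alpha_concave_midpoint:
  assumes "alpha_concave \<alpha> f" "\<alpha> < 0" "f x > 0" "f y > 0"
  shows "f ((1/2) *\<^sub>R x + (1/2) *\<^sub>R y) > 0"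
    and "f ((1/2) *\<^sub>R x + (1/2) *\<^sub>R y) powr \<alpha> \<le> (f x powr \<alpha> + f y powr \<alpha>) / 2"
proof -
  define m where "m = (f x powr \<alpha> + f y powr \<alpha>) / 2"
  have m: "m > 0"
    using assms by (simp add: m_def add_pos_pos)
  have "(1/2) * f x powr \<alpha> + (1 - 1/2) * f y powr \<alpha> = m"
    by (simp add: m_def)
  then have le: "m powr (1 / \<alpha>) \<le> f ((1/2) *\<^sub>R x + (1/2) *\<^sub>R y)"
    using assms(1)[unfolded alpha_concave_def, rule_format, of "1/2" x y] assms by simp
  then show "f ((1/2) *\<^sub>R x + (1/2) *\<^sub>R y) > 0"
    using m by (intro less_le_trans[OF _ le]) simp
  have "f ((1/2) *\<^sub>R x + (1/2) *\<^sub>R y) powr \<alpha> \<le> (m powr (1 / \<alpha>)) powr \<alpha>"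
    using le m assms by (intro powr_mono2') auto
  then show "f ((1/2) *\<^sub>R x + (1/2) *\<^sub>R y) powr \<alpha> \<le> (f x powr \<alpha> + f y powr \<alpha>) / 2"
    using m assms by (simp add: powr_powr m_def)
qed

text \<open>Log-concavity at the two midpoints of \<open>w\<close> with \<open>y\<close> and with \<open>z\<close>: the exponents contributed by
  \<open>w\<close> add up to one full copy of \<open>f w powr \<alpha>\<close>.\<close>

lemma laplace_kernel_midpoint:
  assumes "alpha_concave \<alpha> f" "\<alpha> < 0" "0 \<le> s" "f y > 0" "f z > 0"
  shows "ennreal (exp (- (s * ((f y powr \<alpha> + f z powr \<alpha>) / 2)))) * laplace_kernel \<alpha> f s w \<le>
    laplace_kernel \<alpha> f s ((1/2) *\<^sub>R y + (1/2) *\<^sub>R w) * laplace_kernel \<alpha> f s ((1/2) *\<^sub>R z + (1/2) *\<^sub>R w)"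
proof (cases "f w > 0")
  case True
  note y = alpha_concave_midpoint[OF assms(1,2) \<open>f y > 0\<close> True]
  note z = alpha_concave_midpoint[OF assms(1,2) \<open>f z > 0\<close> True]
  have "s * (f ((1/2) *\<^sub>R y + (1/2) *\<^sub>R w) powr \<alpha> + f ((1/2) *\<^sub>R z + (1/2) *\<^sub>R w) powr \<alpha>) \<le>
      s * ((f y powr \<alpha> + f z powr \<alpha>) / 2 + f w powr \<alpha>)"
    using y(2) z(2) assms(3) by (intro mult_left_mono) (auto simp: field_simps)
  then show ?thesis
    using y(1) z(1) True
    by (simp add: laplace_kernel_def ennreal_mult[symmetric] exp_add[symmetric] algebra_simps)
qed (simp add: laplace_kernel_def)

section \<open>The difference function\<close>

lemma C_alpha_nonneg: "f \<in> C_alpha \<alpha> \<Longrightarrow> 0 \<le> f x"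
  by (simp add: C_alpha_def)

lemma C_alpha_le_one:
  assumes "f \<in> C_alpha \<alpha>"
  shows "f x \<le> 1"
proof -
  have "sup_norm f = 1"
    using assms by (simp add: C_alpha_def)
  moreover have "ereal \<bar>f x\<bar> \<le> sup_norm f"
    unfolding sup_norm_def by (rule SUP_upper) simp
  ultimately show ?thesis by simp
qed

text \<open>Boundedness of \<open>f\<close> enters here: the supremum of an unbounded set of reals would be an
  unspecified number.\<close>

lemma difference_function_nonneg:
  assumes f: "f \<in> C_alpha \<alpha>" and \<alpha>: "\<alpha> < 0"
  shows "0 \<le> difference_function \<alpha> f x"
proof -
  let ?A = "{M_alpha \<alpha> (f y) (f (- z)) | y z. y + z = 2 *\<^sub>R x}"
  have M: "M_alpha \<alpha> a b \<le> 1" if "0 \<le> a" "a \<le> 1" "0 \<le> b" "b \<le> 1" for a b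
  proof -
    have "((a powr \<alpha> + b powr \<alpha>) / 2) powr (1 / \<alpha>) \<le> 1 powr (1 / \<alpha>)" if "a \<noteq> 0" "b \<noteq> 0"
    proof (rule powr_mono2')
      have "1 powr \<alpha> \<le> a powr \<alpha>" "1 powr \<alpha> \<le> b powr \<alpha>"
        using \<alpha> that \<open>0 \<le> a\<close> \<open>a \<le> 1\<close> \<open>0 \<le> b\<close> \<open>b \<le> 1\<close> by (intro powr_mono2'; simp)+
      then show "1 \<le> (a powr \<alpha> + b powr \<alpha>) / 2" by simp
    qed (use \<alpha> in auto)
    then show ?thesis by (auto simp: M_alpha_def)
  qed
  have "bdd_above ?A"
    using M C_alpha_nonneg[OF f] C_alpha_le_one[OF f] by (intro bdd_aboveI[of _ 1]) auto
  moreover have "M_alpha \<alpha> (f (2 *\<^sub>R x)) (f (- 0)) \<in> ?A"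
    by (rule CollectI) (intro exI conjI, rule refl, simp)
  ultimately have "M_alpha \<alpha> (f (2 *\<^sub>R x)) (f (- 0)) \<le> Sup ?A"
    by (rule cSup_upper[rotated])
  moreover have "0 \<le> M_alpha \<alpha> (f (2 *\<^sub>R x)) (f (- 0))"
    by (simp add: M_alpha_def)
  ultimately show ?thesis
    by (simp add: difference_function_def)
qed

text \<open>A pointwise form of the inequality \<open>\<integral> G\<^sub>s \<le> 2\<^sup>n \<integral> g\<^sub>s\<close> for log-concave functions. The
  supremum in the difference function is approached by admissible pairs, so the bound is proved with
  any positive \<open>c\<close> below it in its place, and then passes to the limit.\<close>

lemma laplace_kernel_difference_function_le:
  fixes f :: "'a::euclidean_space \<Rightarrow> real"
  assumes f: "f \<in> C_alpha \<alpha>" and \<alpha>: "\<alpha> < 0" and [measurable]: "f \<in> borel_measurable borel"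
    and s: "0 \<le> s"
  shows "laplace_kernel \<alpha> (difference_function \<alpha> f) s x * (\<integral>\<^sup>+ w. laplace_kernel \<alpha> f s w \<partial>lborel) \<le>
    2 ^ DIM('a) * (\<integral>\<^sup>+ w. laplace_kernel \<alpha> f s (x + w) * laplace_kernel \<alpha> f s w \<partial>lborel)"
proof (cases "difference_function \<alpha> f x > 0")
  case True
  define d where "d = difference_function \<alpha> f x"
  let ?E = "\<integral>\<^sup>+ w. laplace_kernel \<alpha> f s w \<partial>lborel"
  let ?I = "2 ^ DIM('a) * (\<integral>\<^sup>+ w. laplace_kernel \<alpha> f s (x + w) * laplace_kernel \<alpha> f s w \<partial>lborel)"
  have below: "ennreal (exp (- (s * c powr \<alpha>))) * ?E \<le> ?I" if c: "0 < c" "c < d" for c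
  proof -
    let ?A = "{M_alpha \<alpha> (f y) (f (- z)) | y z. y + z = 2 *\<^sub>R x}"
    have "M_alpha \<alpha> (f (2 *\<^sub>R x)) (f (- 0)) \<in> ?A"
      by (rule CollectI) (intro exI conjI, rule refl, simp)
    then obtain y z where yz: "y + z = 2 *\<^sub>R x" "c < M_alpha \<alpha> (f y) (f (- z))"
      using c(2) unfolding d_def difference_function_def by (force elim: less_cSupE)
    define m where "m = (f y powr \<alpha> + f (- z) powr \<alpha>) / 2"
    have pos: "f y > 0" "f (- z) > 0"
      using yz(2) c(1) C_alpha_nonneg[OF f, of y] C_alpha_nonneg[OF f, of "- z"]
      by (auto simp: M_alpha_def split: if_splits)
    have cm: "c < m powr (1 / \<alpha>)"
      using yz(2) pos by (simp add: M_alpha_def m_def)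
    have m: "m > 0"
      using pos by (simp add: m_def add_pos_pos)
    have "(m powr (1 / \<alpha>)) powr \<alpha> \<le> c powr \<alpha>"
      using cm c \<alpha> by (intro powr_mono2') auto
    then have "m \<le> c powr \<alpha>"
      using m \<alpha> by (simp add: powr_powr)
    then have "exp (- (s * c powr \<alpha>)) \<le> exp (- (s * m))"
      using s by (simp add: mult_left_mono)
    then have "ennreal (exp (- (s * c powr \<alpha>))) * ?E \<le> ennreal (exp (- (s * m))) * ?E"
      by (intro mult_right_mono ennreal_leI) auto
    also have "\<dots> \<le> ?I"
    proof (rule covariogram_lower_bound)
      show "y = - z + 2 *\<^sub>R x"
        using yz(1) by (simp add: algebra_simps)
      show "ennreal (exp (- (s * m))) * laplace_kernel \<alpha> f s w \<le> laplace_kernel \<alpha> f s ((1/2) *\<^sub>R y + (1/2) *\<^sub>R w) *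
          laplace_kernel \<alpha> f s ((1/2) *\<^sub>R (- z) + (1/2) *\<^sub>R w)" for w
        unfolding m_def using f \<alpha> s pos by (intro laplace_kernel_midpoint) (auto simp: C_alpha_def)
    qed measurable
    finally show ?thesis .
  qed
  have d: "d > 0" using True by (simp add: d_def)
  have "((\<lambda>c. ennreal (exp (- (s * c powr \<alpha>))) * ?E) \<longlongrightarrow> ennreal (exp (- (s * d powr \<alpha>))) * ?E) (at_left d)"
    using d by (intro tendsto_mult_ennreal) (auto intro!: tendsto_intros)
  moreover have "\<forall>\<^sub>F c in at_left d. ennreal (exp (- (s * c powr \<alpha>))) * ?E \<le> ?I"
    using eventually_at_left_real[OF d] by eventually_elim (auto intro: below)
  ultimately have "ennreal (exp (- (s * d powr \<alpha>))) * ?E \<le> ?I"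
    by (rule tendsto_upperbound) simp
  then show ?thesis
    using True by (simp add: laplace_kernel_def d_def)
qed (simp add: laplace_kernel_def)

text \<open>The pointwise bound, divided by \<open>\<integral> g\<^sub>s\<close> and integrated over \<open>s\<close> against the density of
  Euler's integral, is a majorant of the difference function whose integral over \<open>x\<close> can be
  computed.\<close>

lemma L1_norm_difference_function_le:
  fixes f :: "'a::euclidean_space \<Rightarrow> real"
  assumes f: "f \<in> C_alpha \<alpha>" and \<alpha>: "\<alpha> < 0" and int: "integrable lborel f"
    and full: "full_dim_support f"
  shows "L1_norm (difference_function \<alpha> f) \<le> 2 ^ DIM('a) * L1_norm f"
proof -
  define \<Gamma> where "\<Gamma> = Gamma (- 1 / \<alpha>)"
  define \<omega> where "\<omega> s = ennreal (indicator {0..} s * s powr (- 1 / \<alpha> - 1))" for s :: real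
  define E where "E s = (\<integral>\<^sup>+ w. laplace_kernel \<alpha> f s w \<partial>lborel)" for s
  define I where "I s x = (\<integral>\<^sup>+ w. laplace_kernel \<alpha> f s (x + w) * laplace_kernel \<alpha> f s w \<partial>lborel)" for s x
  have [measurable]: "f \<in> borel_measurable borel"
    using int by simp
  have [measurable]: "\<omega> \<in> borel_measurable borel"
    unfolding \<omega>_def by measurable
  have [measurable]: "E \<in> borel_measurable borel"
    unfolding E_def by measurable
  have [measurable]: "(\<lambda>(s, x). I s x) \<in> borel_measurable (borel \<Otimes>\<^sub>M borel)"
    unfolding I_def by measurable
  have \<Gamma>: "\<Gamma> > 0"
    using \<alpha> by (simp add: \<Gamma>_def Gamma_real_pos divide_neg_neg)
  have fE: "(\<integral>\<^sup>+ s. \<omega> s * E s \<partial>lborel) = ennreal \<Gamma> * L1_norm f"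
  proof -
    have "(\<integral>\<^sup>+ s. \<omega> s * E s \<partial>lborel) = (\<integral>\<^sup>+ s. (\<integral>\<^sup>+ x. \<omega> s * laplace_kernel \<alpha> f s x \<partial>lborel) \<partial>lborel)"
      by (simp add: E_def nn_integral_cmult)
    also have "\<dots> = (\<integral>\<^sup>+ x. (\<integral>\<^sup>+ s. \<omega> s * laplace_kernel \<alpha> f s x \<partial>lborel) \<partial>lborel)"
      by (rule lborel_pair.Fubini') measurable
    also have "\<dots> = ennreal \<Gamma> * L1_norm f"
      unfolding \<omega>_def \<Gamma>_def nn_integral_laplace_kernel[of \<alpha> f, OF \<alpha> C_alpha_nonneg[OF f]]
      using C_alpha_nonneg[OF f] by (simp add: L1_norm_def nn_integral_cmult)
    finally show ?thesis .
  qed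
  have E_pos: "E s \<noteq> 0" for s
  proof
    assume "E s = 0"
    then have "AE x in lborel. laplace_kernel \<alpha> f s x = 0"
      by (simp add: E_def nn_integral_0_iff_AE)
    then have "AE x in lborel. f x = 0"
      by eventually_elim
        (use C_alpha_nonneg[OF f] in \<open>force simp: laplace_kernel_def less_le split: if_splits\<close>)
    then have "L1_norm f = 0"
      by (simp add: L1_norm_def nn_integral_0_iff_AE)
    with L1_norm_pos[OF int full] show False ..
  qed
  \<comment> \<open>Cancelling \<open>E s\<close> in extended reals needs \<open>E s \<noteq> 0\<close> and \<open>E s \<noteq> \<infinity>\<close>. The latter holds for almost
    every \<open>s > 0\<close> because \<open>f\<close> is integrable.\<close>
  have "L1_norm f < \<infinity>"
    using int by (simp add: L1_norm_def integrable_iff_bounded)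
  then have "AE s in lborel. \<omega> s * E s \<noteq> \<infinity>"
    by (intro nn_integral_noteq_infinite) (auto simp: fE ennreal_mult_eq_top_iff)
  then have step: "AE s in lborel. \<omega> s * laplace_kernel \<alpha> (difference_function \<alpha> f) s x \<le>
      \<omega> s * (2 ^ DIM('a) * I s x / E s)" for x
  proof eventually_elim
    case (elim s)
    show ?case
    proof (cases "s > 0")
      case True
      then have "E s \<noteq> top"
        using elim by (auto simp: \<omega>_def ennreal_mult_eq_top_iff)
      have "laplace_kernel \<alpha> (difference_function \<alpha> f) s x =
          laplace_kernel \<alpha> (difference_function \<alpha> f) s x * E s / E s"
        using E_pos \<open>E s \<noteq> top\<close> by (simp add: ennreal_mult_divide_eq)
      also have "\<dots> \<le> 2 ^ DIM('a) * I s x / E s"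
        using laplace_kernel_difference_function_le[OF f \<alpha>, of s x] True
        by (intro divide_right_mono_ennreal) (simp add: E_def I_def)
      finally show ?thesis
        by (intro mult_left_mono) auto
    qed (cases "s = 0"; simp add: \<omega>_def)
  qed
  have "L1_norm (difference_function \<alpha> f) = (\<integral>\<^sup>+ x. ennreal (1 / \<Gamma>) *
      (\<integral>\<^sup>+ s. \<omega> s * laplace_kernel \<alpha> (difference_function \<alpha> f) s x \<partial>lborel) \<partial>lborel)"
    unfolding \<omega>_def L1_norm_def \<Gamma>_def[symmetric]
      nn_integral_laplace_kernel[of \<alpha> "difference_function \<alpha> f",
        OF \<alpha> difference_function_nonneg[OF f \<alpha>]]
    using \<Gamma> difference_function_nonneg[OF f \<alpha>] by (simp add: ennreal_mult[symmetric])
  \<comment> \<open>The majorant is jointly measurable in \<open>s\<close> and \<open>x\<close>, so that Fubini's theorem applies to it.\<close>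
  also have "\<dots> \<le> (\<integral>\<^sup>+ x. ennreal (1 / \<Gamma>) *
      (\<integral>\<^sup>+ s. \<omega> s * (2 ^ DIM('a) * I s x / E s) \<partial>lborel) \<partial>lborel)"
    by (intro nn_integral_mono mult_left_mono nn_integral_mono_AE step) auto
  also have "\<dots> = ennreal (1 / \<Gamma>) *
      (\<integral>\<^sup>+ x. (\<integral>\<^sup>+ s. \<omega> s * (2 ^ DIM('a) * I s x / E s) \<partial>lborel) \<partial>lborel)"
    by (rule nn_integral_cmult) measurable
  also have "(\<integral>\<^sup>+ x. (\<integral>\<^sup>+ s. \<omega> s * (2 ^ DIM('a) * I s x / E s) \<partial>lborel) \<partial>lborel) =
      (\<integral>\<^sup>+ s. (\<integral>\<^sup>+ x. \<omega> s * (2 ^ DIM('a) * I s x / E s) \<partial>lborel) \<partial>lborel)"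
    by (rule lborel_pair.Fubini') measurable
  also have "\<dots> = (\<integral>\<^sup>+ s. \<omega> s * (2 ^ DIM('a) * (E s * E s) / E s) \<partial>lborel)"
    unfolding I_def E_def
    by (simp add: nn_integral_cmult nn_integral_divide nn_integral_covariogram)
  also have "\<dots> \<le> (\<integral>\<^sup>+ s. 2 ^ DIM('a) * (\<omega> s * E s) \<partial>lborel)"
  proof (rule nn_integral_mono)
    fix s
    have "2 ^ DIM('a) * (E s * E s) / E s \<le> 2 ^ DIM('a) * E s"
      using E_pos[of s]
      by (cases "E s = top")
        (auto simp: ennreal_mult_divide_eq ennreal_mult_top mult.assoc[symmetric])
    then show "\<omega> s * (2 ^ DIM('a) * (E s * E s) / E s) \<le> 2 ^ DIM('a) * (\<omega> s * E s)"
      by (metis mult.left_commute mult_left_mono zero_le)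
  qed
  also have "\<dots> = ennreal \<Gamma> * (2 ^ DIM('a) * L1_norm f)"
    by (subst nn_integral_cmult) (simp_all add: fE mult.left_commute)
  finally have "L1_norm (difference_function \<alpha> f) \<le>
      ennreal (1 / \<Gamma>) * (ennreal \<Gamma> * (2 ^ DIM('a) * L1_norm f))"
    by (simp add: mult_left_mono)
  also have "\<dots> = 2 ^ DIM('a) * L1_norm f"
    using \<Gamma> by (simp add: mult.assoc[symmetric] ennreal_mult[symmetric])
  finally show ?thesis .
qed

theorem proposition5p3:
  fixes \<alpha> :: real
  assumes "CARD('n::finite) \<ge> 2"
    and "- 1 / real CARD('n) < \<alpha>" and "\<alpha> < 0"
  shows "best_constant TYPE('n) \<alpha> \<le>
    ennreal (min
      ((real CARD('n) + 1) / 2 ^ CARD('n) * real ((2 * CARD('n)) choose CARD('n)))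
      (2 ^ CARD('n) / (\<Prod>j = 1..CARD('n). (1 + real j * \<alpha>))))"
proof -
  have "admissible_constant TYPE('n) \<alpha> (ennreal (2 ^ CARD('n)))"
    using L1_norm_difference_function_le[where 'a = "real ^ 'n"] assms(3)
    by (simp add: admissible_constant_def flip: ennreal_power)
  then have "best_constant TYPE('n) \<alpha> \<le> ennreal (2 ^ CARD('n))"
    by (simp add: admissible_constant_iff)
  also have "\<dots> \<le> ennreal (min
      ((real CARD('n) + 1) / 2 ^ CARD('n) * real ((2 * CARD('n)) choose CARD('n)))
      (2 ^ CARD('n) / (\<Prod>j = 1..CARD('n). (1 + real j * \<alpha>))))"
    using two_power_le_central_binomial two_power_le_power_div_prod[OF assms(2,3)]
    by (intro ennreal_leI) simp
  finally show ?thesis .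
qed

end
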